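(* Let $G$ and $H$ be finitely generated groups such that $G\approx H$, i.e. $\mathrm{Con}(G)=\mathrm{Con}(H)$. Then $\mathcal{A}(G)=\mathcal{A}(H)$; that is, $G$ and $H$ have the same set of isomorphism types of abelian quotients.
   Context: Let $G$ be a finitely generated group. Given a finite generating sequence $\mathfrak g=(g_1,\dots,g_n)$ of $G$ and a finite (indexed) partition $\mathcal E=\{E_1,\dots,E_m\}$ of $G$ into nonempty, pairwise disjoint subsets, a configuration corresponding to $(\mathfrak g,\mathcal E)$ is an $(n+1)$-tuple $C=(c_0,c_1,\dots,c_n)$ with $1\le c_i\le m$ for each $i$ such that there is $x\in G$ with $x\in E_{c_0}$ and $g_ix\in E_{c_i}$ for each $1\le i\le n$. The set of all configurations corresponding to $(\mathfrak g,\mathcal E)$ is denoted $\mathrm{Con}(\mathfrak g,\mathcal E)$, and $\mathrm{Con}(G)$ denotes the set of all $\mathrm{Con}(\mathfrak g,\mathcal E)$ as $\mathfrak g$ runs over the finite generating sequences of $G$ and $\mathcal E$ over the finite partitions of $G$. Finitely generated groups $G_1,G_2$ are called configuration equivalent, written $G_1\approx G_2$, if $\mathrm{Con}(G_1)=\mathrm{Con}(G_2)$. For a group $G$, $\mathcal{A}(G)$ denotes the set of isomorphism types of abelian quotients $G/N$ ($N$ normal in $G$, $G/N$ abelian). *)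

theory Defs
  imports "HOL-Algebra.Algebra" "HOL-Library.Disjoint_Sets"
begin

definition generating_sequence :: "('a, 'b) monoid_scheme \<Rightarrow> 'a list \<Rightarrow> bool" where
  "generating_sequence G g \<longleftrightarrow> set g \<subseteq> carrier G \<and> generate G (set g) = carrier G"

definition finitely_generated_group :: "('a, 'b) monoid_scheme \<Rightarrow> bool" where
  "finitely_generated_group G \<longleftrightarrow>
     group G \<and> (\<exists>S. finite S \<and> S \<subseteq> carrier G \<and> generate G S = carrier G)"

(* The blocks are nonempty and pairwise disjoint by partition_on; distinctness ensures that
   different indices name different blocks. *)
definition indexed_partition :: "'a set \<Rightarrow> 'a set list \<Rightarrow> bool" where
  "indexed_partition A E \<longleftrightarrow> distinct E \<and> partition_on A (set E)"

(* A configuration (c_0, ..., c_n) is a list of length n + 1 whose entries lie in {1..m}.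
   Lists are indexed from 0, so the generator g_i is g ! (i - 1) and the block E_k is
   E ! (k - 1); the index i of c_i needs no shift. *)
definition configurations ::
    "('a, 'b) monoid_scheme \<Rightarrow> 'a list \<Rightarrow> 'a set list \<Rightarrow> nat list set" where
  "configurations G g E =
     {c. length c = length g + 1 \<and> set c \<subseteq> {1..length E} \<and>
         (\<exists>x \<in> carrier G. x \<in> E ! (c ! 0 - 1) \<and>
            (\<forall>i \<in> {1..length g}. g ! (i - 1) \<otimes>\<^bsub>G\<^esub> x \<in> E ! (c ! i - 1)))}"

definition Con :: "('a, 'b) monoid_scheme \<Rightarrow> nat list set set" where
  "Con G = {configurations G g E | g E.
              generating_sequence G g \<and> indexed_partition (carrier G) E}"

definition configuration_equivalent ::
    "('a, 'c) monoid_scheme \<Rightarrow> ('b, 'd) monoid_scheme \<Rightarrow> bool" (infix \<open>\<approx>\<^sub>c\<close> 50) where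
  "G \<approx>\<^sub>c H \<longleftrightarrow> Con G = Con H"

definition abelian_quotients :: "('a, 'b) monoid_scheme \<Rightarrow> 'a set monoid set" where
  "abelian_quotients G = {G Mod N | N. N \<lhd> G \<and> comm_group (G Mod N)}"

(* The isomorphism types of groups over different HOL types cannot be collected in one set.
   Equality of two sets of isomorphism types is therefore expressed by mutual inclusion up
   to isomorphism of sets of representatives. *)
definition same_isomorphism_types :: "'a monoid set \<Rightarrow> 'b monoid set \<Rightarrow> bool" where
  "same_isomorphism_types \<K> \<L> \<longleftrightarrow>
     (\<forall>K \<in> \<K>. \<exists>L \<in> \<L>. K \<cong> L) \<and> (\<forall>L \<in> \<L>. \<exists>K \<in> \<K>. L \<cong> K)"

end

(* If pi maps G onto a finite group Q and E is the partition of G into the fibres of pi, then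
   the configuration at x determines pi x and all pi (g_i x) = pi (g_i) pi x.  A pair for H
   with the same configurations therefore carries a map f from H onto Q such that
   f (h_i y) = pi (g_i) f y, and y |-> f y (f 1)^-1 is a homomorphism onto Q.  So G and H
   have the same finite quotients.

   Diagonalise the abelianizations as products of k cyclic groups Z/d_i and Z/e_i with
   d_0 | d_1 | ... and e_0 | e_1 | ...  Comparing the largest abelian quotients of exponent n
   gives prod_i gcd (d_i, n) = prod_i gcd (e_i, n) for all n > 0, which forces d_i = e_i up to
   sign.  Hence the abelianizations are isomorphic, and every abelian quotient factors
   through the abelianization. *)

theory Submission
  imports Defs
begin

section \<open>Diagonalisation of finitely generated abelian groups\<close>

text \<open>All sequences serve as domain for every \<open>k\<close>: the carrier is
  \<open>UNIV\<close>, so homomorphisms need no side conditions, and \<open>k\<close> can change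
  while the domain stays the same.\<close>

definition int_seqs :: "(nat \<Rightarrow> int) monoid" where
  "int_seqs = product_group UNIV (\<lambda>_. integer_group)"

lemma int_seqs_simps [simp]:
  "carrier int_seqs = UNIV"
  "v \<otimes>\<^bsub>int_seqs\<^esub> w = (\<lambda>i. v i + w i)"
  "\<one>\<^bsub>int_seqs\<^esub> = (\<lambda>i. 0)"
  by (auto simp: int_seqs_def integer_group_def restrict_UNIV)

lemma group_int_seqs [simp]: "group int_seqs"
  by (simp add: int_seqs_def)

lemma inv_int_seqs [simp]: "inv\<^bsub>int_seqs\<^esub> v = (\<lambda>i. - v i)"
  by (rule group.inv_equality) auto

lemma int_pow_int_seqs: "v [^]\<^bsub>int_seqs\<^esub> (c::int) = (\<lambda>i. c * v i)"
proof -
  have nat_pow: "v [^]\<^bsub>int_seqs\<^esub> (n::nat) = (\<lambda>i. int n * v i)" for n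
    by (induction n) (auto simp: algebra_simps)
  show ?thesis
    by (auto simp: int_pow_def2 nat_pow)
qed

(* Maps on Z^k are encoded as maps on all integer sequences that ignore the entries from k on. *)
definition spans :: "nat \<Rightarrow> ((nat \<Rightarrow> int) \<Rightarrow> 'a) \<Rightarrow> ('a, 'b) monoid_scheme \<Rightarrow> bool" where
  "spans k \<phi> A \<longleftrightarrow> \<phi> \<in> epi int_seqs A \<and> (\<forall>v. (\<forall>i<k. v i = 0) \<longrightarrow> \<phi> v = \<one>\<^bsub>A\<^esub>)"

lemma spans_mono: "spans k \<phi> A \<Longrightarrow> k \<le> l \<Longrightarrow> spans l \<phi> A"
  by (auto simp: spans_def)

lemma spans_hom: "spans k \<phi> A \<Longrightarrow> \<phi> \<in> hom int_seqs A"
  by (auto simp: spans_def epi_def)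

lemma spans_add: "spans k \<phi> A \<Longrightarrow> \<phi> (\<lambda>i. v i + w i) = \<phi> v \<otimes>\<^bsub>A\<^esub> \<phi> w"
  using hom_mult[OF spans_hom, of k \<phi> A v w] by simp

lemma spans_closed: "spans k \<phi> A \<Longrightarrow> \<phi> v \<in> carrier A"
  using hom_in_carrier[OF spans_hom, of k \<phi> A v] by simp

lemma spans_add_eq_one:
  assumes "group A" "spans k \<phi> A" "\<phi> v = \<one>\<^bsub>A\<^esub>" "\<phi> w = \<one>\<^bsub>A\<^esub>"
  shows "\<phi> (\<lambda>i. v i + w i) = \<one>\<^bsub>A\<^esub>"
proof -
  interpret group A by fact
  show ?thesis using assms by (simp add: spans_add)
qed

lemma spans_scale:
  assumes "group A" "spans k \<phi> A"
  shows "\<phi> (\<lambda>i. c * v i) = \<phi> v [^]\<^bsub>A\<^esub> (c::int)"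
  using hom_int_pow[OF spans_hom[OF assms(2)], of v c] assms(1)
  by (simp add: int_pow_int_seqs)

lemma spans_scale_eq_one:
  assumes "group A" "spans k \<phi> A" "\<phi> v = \<one>\<^bsub>A\<^esub>"
  shows "\<phi> (\<lambda>i. c * v i) = \<one>\<^bsub>A\<^esub>"
  using assms by (simp add: spans_scale group.int_pow_one)

section \<open>Change of coordinates by shears\<close>

definition unit_vec :: "nat \<Rightarrow> nat \<Rightarrow> int" where
  "unit_vec j = (\<lambda>i. if i = j then 1 else 0)"

text \<open>Elementary change of basis: \<open>unit_vec j\<close> goes to \<open>unit_vec j\<close>
  plus \<open>q\<close>, and the other unit vectors stay. In the coordinates given by the composite
  with a shear, \<open>q j = 0\<close>, a relation \<open>v\<close> reads
  \<open>shear j (\<lambda>i. - q i) v\<close>.\<close>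

definition shear :: "nat \<Rightarrow> (nat \<Rightarrow> int) \<Rightarrow> (nat \<Rightarrow> int) \<Rightarrow> nat \<Rightarrow> int" where
  "shear j q v = (\<lambda>i. v i + v j * q i)"

lemma shear_uminus: "q j = 0 \<Longrightarrow> shear j q (shear j (\<lambda>i. - q i) v) = v"
  by (auto simp: shear_def)

lemma spans_shear:
  assumes "spans k \<phi> A" "j < k" "q j = 0"
  shows "spans k (\<phi> \<circ> shear j q) A"
proof -
  have "shear j q \<in> hom int_seqs int_seqs"
    by (rule homI) (auto simp: shear_def algebra_simps)
  moreover have "surj (shear j q)"
    using shear_uminus[of q j] assms(3) by (metis surjI)
  ultimately have "shear j q \<in> epi int_seqs int_seqs"
    by (simp add: epi_def)
  then have "\<phi> \<circ> shear j q \<in> epi int_seqs A"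
    using assms(1) by (intro epi_compose) (auto simp: spans_def)
  with assms show ?thesis
    by (simp add: spans_def shear_def)
qed

(* Relations may still have nonzero entries at i \<ge> j, but these are divisible by every d l,
   l < j; this makes the divisors form a chain. *)
definition diagonal_upto ::
    "nat \<Rightarrow> nat \<Rightarrow> ((nat \<Rightarrow> int) \<Rightarrow> 'a) \<Rightarrow> (nat \<Rightarrow> int) \<Rightarrow> ('a, 'b) monoid_scheme \<Rightarrow> bool" where
  "diagonal_upto j k \<phi> d A \<longleftrightarrow> spans k \<phi> A \<and>
     (\<forall>i<j. \<phi> (\<lambda>l. d i * unit_vec i l) = \<one>\<^bsub>A\<^esub>) \<and>
     (\<forall>v. \<phi> v = \<one>\<^bsub>A\<^esub> \<longrightarrow> (\<forall>l<j. \<forall>i<k. l \<le> i \<longrightarrow> d l dvd v i))"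

text \<open>The relations \<open>d m * unit_vec m\<close> with \<open>m < j\<close> have entry 0 at
  \<open>i\<close> and stay put. Entry \<open>i\<close> of any relation is unchanged because
  \<open>q i = 0\<close>, so each \<open>d l\<close> divides it and hence the multiples of it that
  the shear adds elsewhere.\<close>

lemma diagonal_upto_shear:
  assumes "diagonal_upto j k \<phi> d A" "j \<le> i" "i < k" "q i = 0"
  shows "diagonal_upto j k (\<phi> \<circ> shear i q) d A"
proof -
  have "d l dvd v l'" if "\<phi> (shear i q v) = \<one>\<^bsub>A\<^esub>" "l < j" "l' < k" "l \<le> l'" for v l l'
  proof -
    have dvd: "d l dvd shear i q v m" if "m < k" "l \<le> m" for m
      using assms(1) that \<open>\<phi> (shear i q v) = \<one>\<^bsub>A\<^esub>\<close> \<open>l < j\<close> by (auto simp: diagonal_upto_def)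
    have "d l dvd v i"
      using dvd[of i] assms \<open>l < j\<close> by (simp add: shear_def)
    then have "d l dvd v i * q l'" by simp
    with dvd[OF that(3,4)] show ?thesis
      by (simp add: shear_def dvd_add_left_iff)
  qed
  moreover have "shear i q (\<lambda>l. d m * unit_vec m l) = (\<lambda>l. d m * unit_vec m l)" if "m < j" for m
    using that assms(2) by (auto simp: shear_def unit_vec_def)
  ultimately show ?thesis
    using assms spans_shear[of k \<phi> A i q] by (simp add: diagonal_upto_def)
qed

text \<open>Up to entries from \<open>k\<close> on, which \<open>\<phi>\<close> ignores, such a
  \<open>v\<close> is an integer combination of the relations \<open>d i * unit_vec i\<close> with
  \<open>i < j\<close>.\<close>

lemma diagonal_upto_eq_one:
  assumes "group A" "diagonal_upto j k \<phi> d A"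
    and "\<And>i. i < j \<Longrightarrow> d i dvd v i" "\<And>i. j \<le> i \<Longrightarrow> i < k \<Longrightarrow> v i = 0"
  shows "\<phi> v = \<one>\<^bsub>A\<^esub>"
proof -
  have sp: "spans k \<phi> A" using assms by (simp add: diagonal_upto_def)
  have "\<phi> w = \<one>\<^bsub>A\<^esub>" if "n \<le> j" "\<And>i. i < n \<Longrightarrow> d i dvd w i" "\<And>i. n \<le> i \<Longrightarrow> i < k \<Longrightarrow> w i = 0" for n w
    using that
  proof (induction n arbitrary: w)
    case 0
    then show ?case using sp by (auto simp: spans_def)
  next
    case (Suc n)
    obtain c where c: "w n = d n * c" using Suc.prems(2)[of n] by auto
    have "\<phi> (w(n := 0)) = \<one>\<^bsub>A\<^esub>"
      using Suc.prems by (intro Suc.IH) auto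
    moreover have "\<phi> (\<lambda>i. c * (d n * unit_vec n i)) = \<one>\<^bsub>A\<^esub>"
      using assms Suc.prems by (intro spans_scale_eq_one[OF assms(1) sp, of "\<lambda>i. d n * unit_vec n i"])
        (simp add: diagonal_upto_def)
    moreover have "w = (\<lambda>i. (w(n := 0)) i + c * (d n * unit_vec n i))"
      using c by (auto simp: unit_vec_def)
    ultimately show ?case
      using spans_add_eq_one[OF assms(1) sp, of "w(n := 0)" "\<lambda>i. c * (d n * unit_vec n i)"] by simp
  qed
  from this[of j v] assms show ?thesis by auto
qed

(* The new divisor is the least positive entry at an index \<ge> j of any relation, over all
   coordinate systems diagonal up to j; minimality makes it divide all the other entries. *)
lemma diagonal_upto_Suc:
  assumes A: "group A" and diag: "diagonal_upto j k \<phi>\<^sub>0 d A" and "j < k"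
  shows "\<exists>\<phi> c. diagonal_upto (Suc j) k \<phi> (d(j := c)) A"
proof -
  define P where "P m \<longleftrightarrow> 0 < m \<and> (\<exists>\<phi> v i. diagonal_upto j k \<phi> d A \<and> \<phi> v = \<one>\<^bsub>A\<^esub> \<and> j \<le> i \<and> i < k \<and> v i = int m)" for m
  have P: "P (nat (v i))" if "diagonal_upto j k \<phi> d A" "\<phi> v = \<one>\<^bsub>A\<^esub>" "j \<le> i" "i < k" "0 < v i" for \<phi> v i
    using that unfolding P_def by (intro conjI exI[of _ \<phi>] exI[of _ v] exI[of _ i]) simp_all
  show ?thesis
  proof (cases "\<exists>m. P m")
    case False
    \<comment> \<open>Negation carries relations to relations, so negative entries are ruled out
      together with positive ones. The new divisor is 0 and stands for an infinite cyclic
      factor.\<close>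
    have zero: "v i = 0" if "\<phi>\<^sub>0 v = \<one>\<^bsub>A\<^esub>" "j \<le> i" "i < k" for v i
    proof -
      have "\<phi>\<^sub>0 (\<lambda>i. -1 * v i) = \<one>\<^bsub>A\<^esub>"
        using diag that A spans_scale_eq_one[of A k \<phi>\<^sub>0 v "-1"] by (simp add: diagonal_upto_def)
      with that False P[OF diag, of v i] P[OF diag, of "\<lambda>i. -1 * v i" i] show ?thesis
        by (cases "v i" "0::int" rule: linorder_cases) auto
    qed
    have "\<phi>\<^sub>0 (\<lambda>l. 0) = \<one>\<^bsub>A\<^esub>"
      using diag by (auto simp: diagonal_upto_def spans_def)
    then have "diagonal_upto (Suc j) k \<phi>\<^sub>0 (d(j := 0)) A"
      using diag zero by (auto simp: diagonal_upto_def less_Suc_eq)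
    then show ?thesis by blast
  next
    case True
    define m where "m = (LEAST m. P m)"
    have "P m" unfolding m_def using True by (rule LeastI_ex)
    then have "0 < m" by (simp add: P_def)
    have zero: "v i = 0"
      if "diagonal_upto j k \<phi> d A" "\<phi> v = \<one>\<^bsub>A\<^esub>" "j \<le> i" "i < k" "0 \<le> v i" "v i < int m" for \<phi> v i
      using P[OF that(1-4)] that(5,6) not_less_Least[of "nat (v i)" P] \<open>0 < m\<close>
      unfolding m_def[symmetric] by fastforce
    \<comment> \<open>If one entry of a relation equals \<open>m\<close>, a shear at that entry
      replaces any other entry from \<open>j\<close> on by its remainder modulo \<open>m\<close>,
      which minimality forces to be 0.\<close>
    have dvd: "int m dvd v l"
      if D: "diagonal_upto j k \<phi> d A" and "\<phi> v = \<one>\<^bsub>A\<^esub>" "j \<le> i" "i < k" "v i = int m" "j \<le> l" "l < k" for \<phi> v i l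
    proof (cases "l = i")
      case False
      define q where "q = (\<lambda>t. (v l div int m) * unit_vec l t)"
      have q: "q i = 0" using False by (simp add: q_def unit_vec_def)
      define w where "w = shear i (\<lambda>t. - q t) v"
      have "(\<phi> \<circ> shear i q) w = \<one>\<^bsub>A\<^esub>"
        using that shear_uminus[of q, OF q] by (simp add: w_def)
      moreover have wl: "w l = v l mod int m"
        using that by (simp add: w_def shear_def q_def unit_vec_def minus_mult_div_eq_mod)
      ultimately have "w l = 0"
        using diagonal_upto_shear[OF D] that q \<open>0 < m\<close> by (intro zero[where \<phi> = "\<phi> \<circ> shear i q"]) auto
      with wl show ?thesis by auto
    qed (use that in auto)
    obtain \<phi>\<^sub>1 v\<^sub>1 where D1: "diagonal_upto j k \<phi>\<^sub>1 d A" "\<phi>\<^sub>1 v\<^sub>1 = \<one>\<^bsub>A\<^esub>" "v\<^sub>1 j = int m"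
    proof -
      obtain \<phi> v i where D: "diagonal_upto j k \<phi> d A" and v: "\<phi> v = \<one>\<^bsub>A\<^esub>" "j \<le> i" "i < k" "v i = int m"
        using \<open>P m\<close> unfolding P_def by blast
      show thesis
      proof (cases "i = j")
        case False
        obtain s where s: "v j = int m * s" using dvd[OF D v, of j] \<open>j < k\<close> by auto
        \<comment> \<open>By \<open>dvd\<close> the entry at \<open>j\<close> is
          \<open>m * s\<close>; taking away \<open>s - 1\<close> times the entry \<open>m\<close> at
          \<open>i\<close> leaves \<open>m\<close> at \<open>j\<close>.\<close>
        define q where "q = (\<lambda>t. (s - 1) * unit_vec j t)"
        have q: "q i = 0" using False by (simp add: q_def unit_vec_def)
        show thesis
        proof
          show "diagonal_upto j k (\<phi> \<circ> shear i q) d A"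
            using diagonal_upto_shear[OF D] v q by auto
          show "(\<phi> \<circ> shear i q) (shear i (\<lambda>t. - q t) v) = \<one>\<^bsub>A\<^esub>"
            using v shear_uminus[of q, OF q] by simp
          show "shear i (\<lambda>t. - q t) v j = int m"
            using v s by (simp add: shear_def q_def unit_vec_def algebra_simps)
        qed
      qed (use D v that in auto)
    qed
    \<comment> \<open>This shear clears the entries of the relation strictly between
      \<open>j\<close> and \<open>k\<close>, all multiples of \<open>m\<close>, and keeps
      \<open>m\<close> at \<open>j\<close>.\<close>
    define q where "q = (\<lambda>l. if j < l \<and> l < k then v\<^sub>1 l div int m else 0)"
    have q: "q j = 0" by (simp add: q_def)
    define \<phi> where "\<phi> = \<phi>\<^sub>1 \<circ> shear j q"
    define v where "v = shear j (\<lambda>l. - q l) v\<^sub>1"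
    have D: "diagonal_upto j k \<phi> d A"
      unfolding \<phi>_def using diagonal_upto_shear[OF D1(1)] q \<open>j < k\<close> by auto
    then have sp: "spans k \<phi> A" by (simp add: diagonal_upto_def)
    have v: "\<phi> v = \<one>\<^bsub>A\<^esub>"
      using D1 shear_uminus[of q, OF q] by (simp add: \<phi>_def v_def)
    have vj: "v j = int m"
      using D1 by (simp add: v_def shear_def q_def)
    have vl: "v l = 0" if "j < l" "l < k" for l
      using that dvd[OF D1(1,2) _ _ D1(3), of l] D1(3) \<open>j < k\<close> by (simp add: v_def shear_def q_def)
    have unit: "\<phi> (\<lambda>l. int m * unit_vec j l) = \<one>\<^bsub>A\<^esub>"
    proof -
      interpret group A by fact
      \<comment> \<open>Below \<open>j\<close> the entries of \<open>w\<close> are those of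
        \<open>v\<close>, divisible by the old divisors; from \<open>j\<close> up to
        \<open>k\<close> they vanish. So \<open>w\<close> is a relation, and the difference
        \<open>m * unit_vec j\<close> of \<open>v\<close> and \<open>w\<close> is one as
        well.\<close>
      define w where "w = (\<lambda>l. v l - int m * unit_vec j l)"
      have "\<phi> w = \<one>\<^bsub>A\<^esub>"
      proof (rule diagonal_upto_eq_one[OF A D])
        show "d i dvd w i" if "i < j" for i
          using D v that \<open>j < k\<close> by (auto simp: diagonal_upto_def w_def unit_vec_def)
        show "w i = 0" if "j \<le> i" "i < k" for i
          using that vl vj by (auto simp: w_def unit_vec_def)
      qed
      moreover have "\<phi> v = \<phi> w \<otimes>\<^bsub>A\<^esub> \<phi> (\<lambda>l. int m * unit_vec j l)"
        using spans_add[OF sp, of w "\<lambda>l. int m * unit_vec j l"] by (simp add: w_def)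
      ultimately show ?thesis using v spans_closed[OF sp] by simp
    qed
    have adjust: "\<phi> (\<lambda>l. w l + c * (int m * unit_vec j l)) = \<one>\<^bsub>A\<^esub>" if "\<phi> w = \<one>\<^bsub>A\<^esub>" for w c
      using spans_add_eq_one[OF A sp that spans_scale_eq_one[OF A sp unit, of c]] by simp
    have "int m dvd w i" if w: "\<phi> w = \<one>\<^bsub>A\<^esub>" and i: "j \<le> i" "i < k" for w i
    proof -
      \<comment> \<open>Multiples of the relation \<open>m * unit_vec j\<close> are added to
        \<open>w\<close>. The first choice of \<open>c\<close> turns entry \<open>j\<close> into its
        remainder, which is 0 by minimality; the second turns it into \<open>m\<close> itself, so
        that \<open>dvd\<close> applies to the other entries.\<close>
      define u where "u = (\<lambda>c l. w l + c * (int m * unit_vec j l))"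
      have "u (- (w j div int m)) j = w j mod int m"
        by (simp add: u_def unit_vec_def minus_mult_div_eq_mod[symmetric] algebra_simps)
      then have "w j mod int m = 0"
        using zero[OF D adjust[OF w, of "- (w j div int m)"], of j] \<open>0 < m\<close> \<open>j < k\<close> by (simp add: u_def)
      then obtain s where s: "w j = int m * s" by auto
      have "u (1 - s) j = int m"
        using s by (simp add: u_def unit_vec_def algebra_simps)
      then have "int m dvd u (1 - s) i"
        using adjust[OF w, of "1 - s"] i \<open>j < k\<close> by (intro dvd[OF D, of _ j]) (auto simp: u_def)
      then show ?thesis
        using s by (cases "i = j") (auto simp: u_def unit_vec_def)
    qed
    then have "diagonal_upto (Suc j) k \<phi> (d(j := int m)) A"
      using D unit by (auto simp: diagonal_upto_def less_Suc_eq)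
    then show ?thesis by blast
  qed
qed

text \<open>Exhibits \<open>A\<close> as the product of the cyclic groups Z/(d i),
  \<open>i < k\<close>, in invariant factor form: \<open>d i = 0\<close> gives an infinite factor, a
  unit a trivial one. Signs are not normalised.\<close>

definition diagonal ::
    "nat \<Rightarrow> ((nat \<Rightarrow> int) \<Rightarrow> 'a) \<Rightarrow> (nat \<Rightarrow> int) \<Rightarrow> ('a, 'b) monoid_scheme \<Rightarrow> bool" where
  "diagonal k \<phi> d A \<longleftrightarrow> \<phi> \<in> epi int_seqs A \<and>
     (\<forall>v. \<phi> v = \<one>\<^bsub>A\<^esub> \<longleftrightarrow> (\<forall>i<k. d i dvd v i)) \<and>
     (\<forall>l i. l \<le> i \<longrightarrow> i < k \<longrightarrow> d l dvd d i)"

lemma ex_diagonal: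
  assumes "group A" "spans k \<phi> A"
  shows "\<exists>\<phi> d. diagonal k \<phi> d A"
proof -
  have "\<exists>\<phi> d. diagonal_upto j k \<phi> d A" if "j \<le> k" for j
    using that
  proof (induction j)
    case 0
    then show ?case using assms by (auto simp: diagonal_upto_def)
  next
    case (Suc j)
    then show ?case using diagonal_upto_Suc[OF assms(1), of j k] by (metis Suc_le_lessD less_imp_le)
  qed
  then obtain \<phi> d where D: "diagonal_upto k k \<phi> d A" by blast
  have "d l dvd d i" if "l \<le> i" "i < k" for l i
  proof -
    \<comment> \<open>\<open>d i * unit_vec i\<close> is itself a relation, so the divisibility
      clause for relations yields the chain.\<close>
    have "\<phi> (\<lambda>t. d i * unit_vec i t) = \<one>\<^bsub>A\<^esub>"
      using D that by (auto simp: diagonal_upto_def)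
    then have "d l dvd d i * unit_vec i i"
      using D that unfolding diagonal_upto_def by (meson le_less_trans)
    then show ?thesis by (simp add: unit_vec_def)
  qed
  moreover have "\<phi> v = \<one>\<^bsub>A\<^esub> \<longleftrightarrow> (\<forall>i<k. d i dvd v i)" for v
    using D diagonal_upto_eq_one[OF assms(1) D, of v] unfolding diagonal_upto_def by auto
  ultimately have "diagonal k \<phi> d A"
    using D by (auto simp: diagonal_def diagonal_upto_def spans_def)
  then show ?thesis by blast
qed

section \<open>Finite quotients from configurations\<close>

lemma epi_factor:
  assumes "group A" "group B" "group C" and f: "f \<in> epi A B" and g: "g \<in> hom A C"
    and ker: "\<And>x. x \<in> carrier A \<Longrightarrow> f x = \<one>\<^bsub>B\<^esub> \<Longrightarrow> g x = \<one>\<^bsub>C\<^esub>"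
  obtains h where "h \<in> hom B C" "\<And>x. x \<in> carrier A \<Longrightarrow> h (f x) = g x"
proof -
  interpret A: group A by fact
  interpret B: group B by fact
  interpret C: group C by fact
  interpret f: group_hom A B f
    using f by unfold_locales (auto simp: epi_def)
  interpret g: group_hom A C g
    using g by unfold_locales
  have eq: "g x = g y" if "x \<in> carrier A" "y \<in> carrier A" "f x = f y" for x y
  proof -
    have "f (x \<otimes>\<^bsub>A\<^esub> inv\<^bsub>A\<^esub> y) = \<one>\<^bsub>B\<^esub>" using that by simp
    then have "g x \<otimes>\<^bsub>C\<^esub> inv\<^bsub>C\<^esub> g y = \<one>\<^bsub>C\<^esub>" using ker[of "x \<otimes>\<^bsub>A\<^esub> inv\<^bsub>A\<^esub> y"] that by simp
    then show ?thesis using that by (metis C.inv_equality C.inv_inv C.inv_closed g.hom_closed)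
  qed
  define h where "h y = g (SOME x. x \<in> carrier A \<and> f x = y)" for y
  have h: "h (f x) = g x" if "x \<in> carrier A" for x
    unfolding h_def by (rule someI2[of _ x]) (use that in \<open>auto intro: eq\<close>)
  have img: "carrier B = f ` carrier A" using f by (simp add: epi_def)
  have "h \<in> hom B C"
  proof (rule homI)
    show "h (a \<otimes>\<^bsub>B\<^esub> b) = h a \<otimes>\<^bsub>C\<^esub> h b" if ab: "a \<in> carrier B" "b \<in> carrier B" for a b
    proof -
      obtain x y where "x \<in> carrier A" "y \<in> carrier A" "a = f x" "b = f y"
        using ab unfolding img by blast
      then show ?thesis using h[of "x \<otimes>\<^bsub>A\<^esub> y"] by (simp add: h)
    qed
  qed (auto simp: img h)
  with h that show thesis by blast
qed

section \<open>Configurations as a function of the base point\<close>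

definition block_index :: "'a set list \<Rightarrow> 'a \<Rightarrow> nat" where
  "block_index E x = (THE k. k < length E \<and> x \<in> E ! k)"

lemma block_index_eq:
  assumes "indexed_partition A E" "k < length E" "x \<in> E ! k"
  shows "block_index E x = k"
  unfolding block_index_def
proof (rule the_equality)
  fix l assume "l < length E \<and> x \<in> E ! l"
  with assms show "l = k"
    unfolding indexed_partition_def partition_on_def disjoint_def
    by (metis IntI empty_iff nth_eq_iff_index_eq nth_mem)
qed (use assms in auto)

lemma block_index:
  assumes "indexed_partition A E" "x \<in> A"
  shows "block_index E x < length E" "x \<in> E ! block_index E x"
proof -
  have "x \<in> \<Union>(set E)" using assms by (auto simp: indexed_partition_def partition_on_def)
  then obtain k where "k < length E" "x \<in> E ! k" by (auto simp: in_set_conv_nth)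
  with block_index_eq[OF assms(1) this]
  show "block_index E x < length E" "x \<in> E ! block_index E x" by auto
qed

text \<open>\<open>block_index\<close> counts from 0, the entries of a configuration from 1;
  \<open>Suc\<close> makes up for it.\<close>

definition configuration_at ::
    "('a, 'b) monoid_scheme \<Rightarrow> 'a list \<Rightarrow> 'a set list \<Rightarrow> 'a \<Rightarrow> nat list" where
  "configuration_at G g E x =
     Suc (block_index E x) # map (\<lambda>a. Suc (block_index E (a \<otimes>\<^bsub>G\<^esub> x))) g"

lemma configuration_at_eqD:
  assumes "configuration_at G g E x = configuration_at H h F y"
  shows "block_index E x = block_index F y" "length g = length h"
    and "i < length g \<Longrightarrow> block_index E (g ! i \<otimes>\<^bsub>G\<^esub> x) = block_index F (h ! i \<otimes>\<^bsub>H\<^esub> y)"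
proof -
  have eq: "map (\<lambda>a. Suc (block_index E (a \<otimes>\<^bsub>G\<^esub> x))) g = map (\<lambda>a. Suc (block_index F (a \<otimes>\<^bsub>H\<^esub> y))) h"
    and "block_index E x = block_index F y"
    using assms unfolding configuration_at_def list.inject nat.inject by blast+
  then show "block_index E x = block_index F y" by blast
  show len: "length g = length h"
    using eq by (rule map_eq_imp_length_eq)
  show "block_index E (g ! i \<otimes>\<^bsub>G\<^esub> x) = block_index F (h ! i \<otimes>\<^bsub>H\<^esub> y)" if "i < length g"
    using arg_cong[OF eq, of "\<lambda>xs. xs ! i"] that len by simp
qed

lemma configurations_eq_image:
  assumes "group G" "set g \<subseteq> carrier G" and E: "indexed_partition (carrier G) E"
  shows "configurations G g E = configuration_at G g E ` carrier G"
proof -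
  interpret group G by fact
  note bi = block_index[OF E]
  show ?thesis
  proof (intro equalityI subsetI)
    fix c assume c: "c \<in> configurations G g E"
    then obtain x where x: "x \<in> carrier G" "x \<in> E ! (c ! 0 - 1)"
      and gx: "\<And>i. i \<in> {1..length g} \<Longrightarrow> g ! (i - 1) \<otimes>\<^bsub>G\<^esub> x \<in> E ! (c ! i - 1)"
      by (auto simp: configurations_def)
    \<comment> \<open>Entries are at least 1, so the truncated subtraction in
      \<open>c ! i - 1\<close> loses nothing and \<open>Suc\<close> undoes it.\<close>
    have ran: "c ! i \<in> {1..length E}" if "i < length c" for i
      using c that by (auto simp: configurations_def subset_iff)
    have len: "length c = length g + 1" using c by (auto simp: configurations_def)
    have "c ! i = configuration_at G g E x ! i" if i: "i < length c" for i
    proof -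
      have "block_index E y = c ! i - 1" if "y \<in> E ! (c ! i - 1)" for y
        using ran[OF i] that by (intro block_index_eq[OF E]) auto
      then have "Suc (block_index E y) = c ! i" if "y \<in> E ! (c ! i - 1)" for y
        using ran[OF i] that by auto
      with x gx[of i] i len show ?thesis
        by (cases i) (auto simp: configuration_at_def)
    qed
    then have "c = configuration_at G g E x"
      using len by (intro nth_equalityI) (auto simp: configuration_at_def)
    with x show "c \<in> configuration_at G g E ` carrier G" by blast
  next
    fix c assume "c \<in> configuration_at G g E ` carrier G"
    then obtain x where x: "x \<in> carrier G" and c: "c = configuration_at G g E x" by blast
    have gx: "g ! i \<otimes>\<^bsub>G\<^esub> x \<in> carrier G" if "i < length g" for i
      using that assms(2) x by (auto simp: subset_iff)
    have "set c \<subseteq> {1..length E}"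
      using bi(1) x assms(2) by (auto simp: c configuration_at_def Suc_le_eq subset_iff)
    moreover have "g ! (i - 1) \<otimes>\<^bsub>G\<^esub> x \<in> E ! (c ! i - 1)" if "i \<in> {1..length g}" for i
      using that bi(2)[OF gx[of "i - 1"]] by (cases i) (auto simp: c configuration_at_def)
    ultimately show "c \<in> configurations G g E"
      using x bi(2)[OF x] by (auto simp: configurations_def c configuration_at_def)
  qed
qed

text \<open>Since \<open>Q\<close> is finite, the fibres of \<open>\<pi>\<close> form an admissible
  partition. Its configuration set records how the generators act on \<open>Q\<close>, and a pair
  for \<open>H\<close> with the same set inherits this action.\<close>

lemma Con_eq_imp_finite_quotient:
  assumes "group G" "group H" "finitely_generated_group G" "G \<approx>\<^sub>c H"
    and "group Q" "finite (carrier Q)" and \<pi>: "\<pi> \<in> epi G Q"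
  shows "\<exists>\<chi>. \<chi> \<in> epi H Q"
proof -
  interpret G: group G by fact
  interpret H: group H by fact
  interpret Q: group Q by fact
  interpret \<pi>: group_hom G Q \<pi>
    using \<pi> by unfold_locales (auto simp: epi_def)
  have \<pi>_img: "\<pi> ` carrier G = carrier Q" using \<pi> by (simp add: epi_def)
  obtain S where "finite S" "S \<subseteq> carrier G" "generate G S = carrier G"
    using assms(3) by (auto simp: finitely_generated_group_def)
  then obtain g where g: "generating_sequence G g"
    unfolding generating_sequence_def by (metis finite_list)
  obtain qs where qs: "distinct qs" "set qs = carrier Q"
    using finite_distinct_list[OF \<open>finite (carrier Q)\<close>] by blast
  define fib where "fib q = {x \<in> carrier G. \<pi> x = q}" for q
  \<comment> \<open>Block number \<open>k\<close> is the fibre over \<open>qs ! k\<close>, so the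
    block index of a point reveals its image in \<open>Q\<close>.\<close>
  define E where "E = map fib qs"
  have fib_ne: "fib q \<noteq> {}" if "q \<in> carrier Q" for q
    using that by (auto simp: fib_def simp flip: \<pi>_img)
  have inj: "inj_on fib (set qs)"
    using fib_ne unfolding qs by (intro inj_onI) (auto simp: fib_def)
  have E: "indexed_partition (carrier G) E"
    unfolding indexed_partition_def partition_on_def
  proof (intro conjI disjointI)
    show "distinct E" using qs inj by (simp add: E_def distinct_map)
    show "\<Union> (set E) = carrier G" using qs by (auto simp: E_def fib_def)
    show "{} \<notin> set E"
      using qs fib_ne by (force simp: E_def)
    show "p \<inter> p' = {}" if "p \<in> set E" "p' \<in> set E" "p \<noteq> p'" for p p'
      using that by (auto simp: E_def fib_def)
  qed
  have qs_index: "qs ! block_index E x = \<pi> x" if "x \<in> carrier G" for x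
  proof -
    have "x \<in> fib (qs ! block_index E x)"
      using block_index[OF E that] nth_map[of _ qs fib] unfolding E_def by (metis length_map)
    then show ?thesis by (simp add: fib_def)
  qed
  have "configurations G g E \<in> Con H"
    using g E assms(4) by (auto simp: configuration_equivalent_def Con_def)
  then obtain h F where h: "generating_sequence H h" and F: "indexed_partition (carrier H) F"
    and conf: "configurations G g E = configurations H h F"
    by (auto simp: Con_def)
  have conf: "configuration_at G g E ` carrier G = configuration_at H h F ` carrier H"
    using conf g h configurations_eq_image[OF assms(1) _ E] configurations_eq_image[OF assms(2) _ F]
    unfolding generating_sequence_def by metis
  have hc: "set h \<subseteq> carrier H" and gc: "set g \<subseteq> carrier G"
    using g h by (auto simp: generating_sequence_def)
  define f where "f y = qs ! block_index F y" for y
  \<comment> \<open>Each \<open>y\<close> in \<open>H\<close> shares its configuration with some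
    \<open>x\<close> in \<open>G\<close>, so that \<open>f y\<close> is \<open>\<pi> x\<close>. The
    match also keeps the block index within the range of \<open>qs\<close>.\<close>
  have match: "\<exists>x\<in>carrier G. configuration_at G g E x = configuration_at H h F y"
    if "y \<in> carrier H" for y
  proof -
    have "configuration_at H h F y \<in> configuration_at G g E ` carrier G"
      unfolding conf using that by (rule imageI)
    then show ?thesis by (rule imageE) auto
  qed
  have f_closed: "f y \<in> carrier Q" if y: "y \<in> carrier H" for y
  proof -
    obtain x where "x \<in> carrier G" "configuration_at G g E x = configuration_at H h F y"
      using match[OF y] by blast
    then show ?thesis
      using qs_index[of x] \<pi>.hom_closed[of x] configuration_at_eqD(1)[of G g E x H h F y]
      unfolding f_def by metis
  qed
  have f_surj: "\<exists>y\<in>carrier H. f y = q" if q: "q \<in> carrier Q" for q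
  proof -
    obtain x where x: "x \<in> carrier G" "\<pi> x = q" using q unfolding \<pi>_img[symmetric] by blast
    then have "configuration_at G g E x \<in> configuration_at H h F ` carrier H"
      unfolding conf[symmetric] by (intro imageI)
    then obtain y where y: "configuration_at G g E x = configuration_at H h F y" "y \<in> carrier H"
      by (rule imageE)
    then show ?thesis
      using qs_index[of x] x configuration_at_eqD(1)[OF y(1)] unfolding f_def by metis
  qed
  (* Left translation by y in H corresponds under f to left multiplication by an element of Q;
     this property passes from the generators to all of H. *)
  define translates where
    "translates y \<longleftrightarrow> y \<in> carrier H \<and> (\<exists>q\<in>carrier Q. \<forall>z\<in>carrier H. f (y \<otimes>\<^bsub>H\<^esub> z) = q \<otimes>\<^bsub>Q\<^esub> f z)" for y
  have translates_gen: "translates a" if "a \<in> set h" for a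
  proof -
    obtain i where i: "i < length h" "a = h ! i" using \<open>a \<in> set h\<close> by (auto simp: in_set_conv_nth)
    have len: "length g = length h"
      using match[OF H.one_closed] by (elim bexE) (rule configuration_at_eqD(2))
    then have gi: "g ! i \<in> carrier G" using i gc len by (auto simp: subset_iff)
    have "f (a \<otimes>\<^bsub>H\<^esub> z) = \<pi> (g ! i) \<otimes>\<^bsub>Q\<^esub> f z" if z: "z \<in> carrier H" for z
    proof -
      obtain x where x: "x \<in> carrier G" "configuration_at G g E x = configuration_at H h F z"
        using match[OF z] by blast
      have "\<pi> (g ! i) \<otimes>\<^bsub>Q\<^esub> f z = \<pi> (g ! i \<otimes>\<^bsub>G\<^esub> x)"
        using x gi qs_index[of x] configuration_at_eqD(1)[OF x(2)] by (simp add: f_def)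
      also have "\<dots> = f (a \<otimes>\<^bsub>H\<^esub> z)"
        using x gi i len qs_index[of "g ! i \<otimes>\<^bsub>G\<^esub> x"] configuration_at_eqD(3)[OF x(2), of i]
        by (simp add: f_def)
      finally show ?thesis by simp
    qed
    then show ?thesis
      using \<pi>.hom_closed[OF gi] hc \<open>a \<in> set h\<close> unfolding translates_def
      by (intro conjI bexI[of _ "\<pi> (g ! i)"]) (simp_all add: subset_iff)
  qed
  have translates_inv: "translates (inv\<^bsub>H\<^esub> y)" if ty: "translates y" for y
  proof -
    obtain q where y: "y \<in> carrier H" "q \<in> carrier Q"
      and q: "\<And>z. z \<in> carrier H \<Longrightarrow> f (y \<otimes>\<^bsub>H\<^esub> z) = q \<otimes>\<^bsub>Q\<^esub> f z"
      using ty by (auto simp: translates_def)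
    have "f (inv\<^bsub>H\<^esub> y \<otimes>\<^bsub>H\<^esub> z) = inv\<^bsub>Q\<^esub> q \<otimes>\<^bsub>Q\<^esub> f z" if z: "z \<in> carrier H" for z
    proof -
      have "f z = q \<otimes>\<^bsub>Q\<^esub> f (inv\<^bsub>H\<^esub> y \<otimes>\<^bsub>H\<^esub> z)"
        using q[of "inv\<^bsub>H\<^esub> y \<otimes>\<^bsub>H\<^esub> z"] y z by (simp flip: H.m_assoc)
      then show ?thesis
        using y z f_closed by (simp flip: Q.m_assoc)
    qed
    then show ?thesis using y by (auto simp: translates_def)
  qed
  have translates: "translates y" if "y \<in> carrier H" for y
  proof -
    have "y \<in> generate H (set h)" using that h by (simp add: generating_sequence_def)
    then show ?thesis
    proof (induction rule: generate.induct)
      case one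
      then show ?case
        unfolding translates_def using f_closed by (auto intro!: bexI[of _ "\<one>\<^bsub>Q\<^esub>"])
    next
      case (eng a b)
      then obtain p q where pq: "a \<in> carrier H" "b \<in> carrier H" "p \<in> carrier Q" "q \<in> carrier Q"
        and p: "\<And>z. z \<in> carrier H \<Longrightarrow> f (a \<otimes>\<^bsub>H\<^esub> z) = p \<otimes>\<^bsub>Q\<^esub> f z"
        and q: "\<And>z. z \<in> carrier H \<Longrightarrow> f (b \<otimes>\<^bsub>H\<^esub> z) = q \<otimes>\<^bsub>Q\<^esub> f z"
        by (auto simp: translates_def)
      have "f (a \<otimes>\<^bsub>H\<^esub> b \<otimes>\<^bsub>H\<^esub> z) = (p \<otimes>\<^bsub>Q\<^esub> q) \<otimes>\<^bsub>Q\<^esub> f z" if "z \<in> carrier H" for z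
        using that pq f_closed by (simp add: H.m_assoc Q.m_assoc p q)
      then show ?case
        using pq unfolding translates_def by (intro conjI bexI[of _ "p \<otimes>\<^bsub>Q\<^esub> q"]) simp_all
    qed (auto intro: translates_gen translates_inv)
  qed
  \<comment> \<open>Putting \<open>z\<close> equal to the identity shows that translation by
    \<open>y\<close> corresponds to the factor \<open>f y\<close> times the inverse of the value of
    \<open>f\<close> at the identity. \<open>\<chi>\<close> selects this factor.\<close>
  define \<chi> where "\<chi> y = f y \<otimes>\<^bsub>Q\<^esub> inv\<^bsub>Q\<^esub> f \<one>\<^bsub>H\<^esub>" for y
  have "\<chi> \<in> hom H Q"
  proof (rule homI)
    fix y z assume y: "y \<in> carrier H" and z: "z \<in> carrier H"
    obtain q where q: "q \<in> carrier Q" "\<And>z. z \<in> carrier H \<Longrightarrow> f (y \<otimes>\<^bsub>H\<^esub> z) = q \<otimes>\<^bsub>Q\<^esub> f z"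
      using translates[OF y] by (auto simp: translates_def)
    have "f y = q \<otimes>\<^bsub>Q\<^esub> f \<one>\<^bsub>H\<^esub>" using q(2)[of "\<one>\<^bsub>H\<^esub>"] y by simp
    then show "\<chi> (y \<otimes>\<^bsub>H\<^esub> z) = \<chi> y \<otimes>\<^bsub>Q\<^esub> \<chi> z"
      using q f_closed y z by (simp add: \<chi>_def Q.m_assoc)
  qed (use f_closed in \<open>auto simp: \<chi>_def\<close>)
  moreover have "carrier Q \<subseteq> \<chi> ` carrier H"
  proof
    fix q assume q: "q \<in> carrier Q"
    then obtain y where "y \<in> carrier H" "f y = q \<otimes>\<^bsub>Q\<^esub> f \<one>\<^bsub>H\<^esub>"
      using f_surj[of "q \<otimes>\<^bsub>Q\<^esub> f \<one>\<^bsub>H\<^esub>"] f_closed by auto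
    then show "q \<in> \<chi> ` carrier H"
      using q f_closed by (intro image_eqI[of _ _ y]) (auto simp: \<chi>_def Q.m_assoc)
  qed
  ultimately show ?thesis by (auto simp: epi_iff_subset)
qed

section \<open>Elementary divisors\<close>

lemma diagonal_hom: "diagonal k \<phi> d A \<Longrightarrow> \<phi> \<in> hom int_seqs A"
  by (simp add: diagonal_def epi_def)

text \<open>This is A/nA for the group \<open>A\<close> with divisors \<open>d\<close>: the quotient
  of Z/(d i) by its n-th multiples is cyclic of order gcd (d i, n). For \<open>n > 0\<close> it is
  finite even where \<open>d i = 0\<close>.\<close>

definition residue_product :: "nat \<Rightarrow> (nat \<Rightarrow> int) \<Rightarrow> nat \<Rightarrow> (nat \<Rightarrow> int) monoid" where
  "residue_product k d n = product_group {..<k} (\<lambda>i. integer_mod_group (nat (gcd (d i) (int n))))"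

lemma residue_product:
  assumes "n > 0"
  shows "group (residue_product k d n)"
    and "carrier (residue_product k d n) = (\<Pi>\<^sub>E i\<in>{..<k}. {0..<gcd (d i) (int n)})"
    and "finite (carrier (residue_product k d n))"
    and "card (carrier (residue_product k d n)) = (\<Prod>i<k. nat (gcd (d i) (int n)))"
proof -
  show "group (residue_product k d n)"
    by (simp add: residue_product_def)
  have "\<not> gcd (d i) (int n) \<le> 0" for i
    using assms by (simp add: not_le)
  then show c: "carrier (residue_product k d n) = (\<Pi>\<^sub>E i\<in>{..<k}. {0..<gcd (d i) (int n)})"
    by (simp add: residue_product_def carrier_integer_mod_group)
  show "finite (carrier (residue_product k d n))"
    by (simp add: c finite_PiE)
  show "card (carrier (residue_product k d n)) = (\<Prod>i<k. nat (gcd (d i) (int n)))"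
    by (simp add: c card_PiE)
qed

text \<open>Reduction of coordinates modulo gcd (d i, n) kills the relations because the modulus
  divides \<open>d i\<close>, and kills n-th powers because it divides \<open>n\<close>.\<close>

lemma diagonal_epi_residue_product:
  assumes "comm_group A" "diagonal k \<phi> d A" "n > 0"
  obtains \<chi> where "\<chi> \<in> epi A (residue_product k d n)"
    "\<And>a. a \<in> carrier A \<Longrightarrow> \<chi> (a [^]\<^bsub>A\<^esub> int n) = \<one>\<^bsub>residue_product k d n\<^esub>"
proof -
  interpret comm_group A by fact
  define m where "m i = gcd (d i) (int n)" for i
  have m: "m i > 0" for i using \<open>n > 0\<close> by (simp add: m_def)
  define Q where "Q = residue_product k d n"
  note Q = residue_product[OF \<open>n > 0\<close>, of k d, folded Q_def m_def]
  have one: "\<one>\<^bsub>Q\<^esub> = (\<lambda>i\<in>{..<k}. 0)"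
    by (simp add: Q_def residue_product_def)
  have mult: "x \<otimes>\<^bsub>Q\<^esub> y = (\<lambda>i\<in>{..<k}. (x i + y i) mod m i)" for x y
    using m by (simp add: Q_def residue_product_def m_def)
  define \<rho> where "\<rho> v = (\<lambda>i\<in>{..<k}. v i mod m i)" for v :: "nat \<Rightarrow> int"
  have \<phi>: "\<phi> \<in> epi int_seqs A" using assms by (simp add: diagonal_def)
  have \<rho>: "\<rho> \<in> hom int_seqs Q"
  proof (rule homI)
    show "\<rho> v \<in> carrier Q" for v using m by (auto simp: Q \<rho>_def)
    show "\<rho> (v \<otimes>\<^bsub>int_seqs\<^esub> w) = \<rho> v \<otimes>\<^bsub>Q\<^esub> \<rho> w" for v w
      by (auto simp: \<rho>_def mult mod_add_eq)
  qed
  have \<rho>_one: "\<rho> v = \<one>\<^bsub>Q\<^esub>" if "\<And>i. i < k \<Longrightarrow> m i dvd v i" for v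
    using that by (auto simp: \<rho>_def one)
  have "\<rho> v = \<one>\<^bsub>Q\<^esub>" if "\<phi> v = \<one>\<^bsub>A\<^esub>" for v
  proof (rule \<rho>_one)
    show "m i dvd v i" if "i < k" for i
      using assms(2) \<open>\<phi> v = \<one>\<^bsub>A\<^esub>\<close> that dvd_trans[OF gcd_dvd1, of "d i" "v i" "int n"]
      by (simp add: diagonal_def m_def)
  qed
  then obtain \<chi> where \<chi>: "\<chi> \<in> hom A Q" "\<And>v. \<chi> (\<phi> v) = \<rho> v"
    using epi_factor[OF group_int_seqs is_group Q(1) \<phi> \<rho>] by auto
  have surj: "\<exists>v. a = \<phi> v" if "a \<in> carrier A" for a
    using \<phi> that by (auto simp: epi_def)
  have "q \<in> \<chi> ` carrier A" if "q \<in> carrier Q" for q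
  proof -
    have "\<rho> q = q" using that unfolding Q \<rho>_def by (fastforce simp: PiE_iff extensional_def)
    then have "q = \<chi> (\<phi> q)" using \<chi> by simp
    then show ?thesis using \<phi> by (auto simp: epi_def)
  qed
  with \<chi> have "\<chi> \<in> epi A Q" by (auto simp: epi_iff_subset)
  moreover have "\<chi> (a [^]\<^bsub>A\<^esub> int n) = \<one>\<^bsub>Q\<^esub>" if a: "a \<in> carrier A" for a
  proof -
    obtain v where v: "a = \<phi> v" using surj[OF a] by blast
    have "a [^]\<^bsub>A\<^esub> int n = \<phi> (\<lambda>i. int n * v i)"
      using hom_int_pow[OF diagonal_hom[OF assms(2)], of v "int n"] is_group
      by (simp add: v int_pow_int_seqs)
    then show ?thesis using \<chi>(2) by (auto intro!: \<rho>_one simp: m_def)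
  qed
  ultimately show thesis using that unfolding Q_def by blast
qed

text \<open>In a quotient of exponent dividing \<open>n\<close>, both \<open>d i\<close> and
  \<open>n\<close> annihilate coordinate \<open>i\<close>, hence so does their gcd. The images of
  reduced residue vectors therefore exhaust \<open>Q\<close>.\<close>

lemma diagonal_epi_card_le:
  assumes "group A" "diagonal k \<phi> d A" "n > 0" "group Q" and \<chi>: "\<chi> \<in> epi A Q"
    and exponent: "\<And>q. q \<in> carrier Q \<Longrightarrow> q [^]\<^bsub>Q\<^esub> int n = \<one>\<^bsub>Q\<^esub>"
  shows "card (carrier Q) \<le> (\<Prod>i<k. nat (gcd (d i) (int n)))"
proof -
  interpret A: group A by fact
  interpret Q: group Q by fact
  define \<psi> where "\<psi> = \<chi> \<circ> \<phi>"
  have \<psi>: "\<psi> \<in> epi int_seqs Q"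
    using assms(2) \<chi> unfolding \<psi>_def by (intro epi_compose) (auto simp: diagonal_def)
  then have hom: "\<psi> \<in> hom int_seqs Q" by (simp add: epi_def)
  have add: "\<psi> (\<lambda>i. v i + w i) = \<psi> v \<otimes>\<^bsub>Q\<^esub> \<psi> w" for v w
    using hom_mult[OF hom, of v w] by simp
  have closed: "\<psi> v \<in> carrier Q" for v
    using hom_in_carrier[OF hom, of v] by simp
  have diag: "\<psi> v = \<one>\<^bsub>Q\<^esub>" if "\<And>i. i < k \<Longrightarrow> d i dvd v i" for v
  proof -
    have "\<phi> v = \<one>\<^bsub>A\<^esub>" using assms(2) that by (simp add: diagonal_def)
    moreover have "\<chi> \<in> hom A Q" using \<chi> by (simp add: epi_def)
    ultimately show ?thesis using hom_one[of \<chi> A Q] A.is_group Q.is_group by (simp add: \<psi>_def)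
  qed
  have mult: "\<psi> (\<lambda>i. int n * v i) = \<one>\<^bsub>Q\<^esub>" for v
    using hom_int_pow[OF hom, of v "int n"] exponent[OF closed[of v]] Q.is_group
    by (simp add: int_pow_int_seqs)
  define R where "R = (\<Pi>\<^sub>E i\<in>{..<k}. {0..<gcd (d i) (int n)})"
  have "carrier Q \<subseteq> \<psi> ` R"
  proof
    fix q assume "q \<in> carrier Q"
    then obtain v where v: "q = \<psi> v" using \<psi> by (auto simp: epi_def)
    define w where "w = (\<lambda>i\<in>{..<k}. v i mod gcd (d i) (int n))"
    define t where "t i = v i div gcd (d i) (int n)" for i
    have "\<exists>x y. x * d i + y * int n = gcd (d i) (int n)" for i
      using bezout_int by blast
    then obtain x y where xy: "\<And>i. x i * d i + y i * int n = gcd (d i) (int n)" by metis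
    \<comment> \<open>Bezout splits \<open>v - w\<close> into a sequence killed by the relations and
      an \<open>n\<close>-th multiple. From \<open>k\<close> on, where \<open>w\<close> takes a
      default value, \<open>v\<^sub>1\<close> is chosen to make the sum right; the relations leave
      those entries free.\<close>
    define v\<^sub>1 where "v\<^sub>1 i = (if i < k then d i * (x i * t i) else v i - w i - int n * (y i * t i))" for i
    have "v i = w i + (v\<^sub>1 i + int n * (y i * t i))" for i
    proof (cases "i < k")
      case True
      have "v i = w i + gcd (d i) (int n) * t i"
        using True by (simp add: w_def t_def)
      also have "\<dots> = w i + (v\<^sub>1 i + int n * (y i * t i))"
        using True by (simp add: v\<^sub>1_def algebra_simps flip: xy[of i])
      finally show ?thesis .
    qed (simp add: v\<^sub>1_def)
    then have "v = (\<lambda>i. w i + (v\<^sub>1 i + int n * (y i * t i)))" by blast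
    then have "q = \<psi> w \<otimes>\<^bsub>Q\<^esub> (\<psi> v\<^sub>1 \<otimes>\<^bsub>Q\<^esub> \<psi> (\<lambda>i. int n * (y i * t i)))"
      using add[of w "\<lambda>i. v\<^sub>1 i + int n * (y i * t i)"] add[of v\<^sub>1 "\<lambda>i. int n * (y i * t i)"]
      by (simp add: v)
    also have "\<dots> = \<psi> w"
      using diag[of v\<^sub>1] mult[of "\<lambda>i. y i * t i"] closed by (simp add: v\<^sub>1_def)
    finally have "q = \<psi> w" .
    moreover have "w \<in> R"
      using \<open>n > 0\<close> by (auto simp: w_def R_def)
    ultimately show "q \<in> \<psi> ` R" by blast
  qed
  moreover have "finite R" by (simp add: R_def finite_PiE)
  ultimately have "card (carrier Q) \<le> card R" by (rule surj_card_le[rotated])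
  also have "card R = (\<Prod>i<k. nat (gcd (d i) (int n)))"
    by (simp add: R_def card_PiE)
  finally show ?thesis .
qed

text \<open>Inductive step for comparing two lists of divisors, to be applied with \<open>d\<close>
  and \<open>e\<close> exchanged as well. The earlier divisors agree up to sign, so their factors
  cancel from the products; divisibility is then tested on the positive divisors \<open>n\<close> of
  \<open>d j\<close>.\<close>

lemma elementary_divisor_dvd:
  fixes d e :: "nat \<Rightarrow> int"
  assumes chain: "\<And>l i. l \<le> i \<Longrightarrow> i < k \<Longrightarrow> d l dvd d i"
    and prod: "\<And>n::nat. n > 0 \<Longrightarrow> (\<Prod>i<k. nat (gcd (d i) (int n))) = (\<Prod>i<k. nat (gcd (e i) (int n)))"
    and below: "\<And>i. i < j \<Longrightarrow> d i dvd e i \<and> e i dvd d i" and "j < k"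
  shows "d j dvd e j"
proof -
  (* If n divides d j, the factors from j on multiply to n ^ (k - j) for d, so also for e. *)
  have *: "int n dvd e j" if "n > 0" "int n dvd d j" for n
  proof (rule ccontr)
    assume not_dvd: "\<not> int n dvd e j"
    define a where "a i = nat (gcd (d i) (int n))" for i
    define b where "b i = nat (gcd (e i) (int n))" for i
    have split: "{..<k} = {..<j} \<union> {j..<k}" using \<open>j < k\<close> by auto
    have "a i = b i" if "i < j" for i
    proof -
      have "gcd (d i) (int n) = gcd (e i) (int n)"
        using below[OF that] by (intro zdvd_antisym_nonneg) (auto intro: dvd_trans[OF gcd_dvd1])
      then show ?thesis by (simp add: a_def b_def)
    qed
    then have "prod a {..<j} = prod b {..<j}" by simp
    moreover have "prod a {..<k} = prod b {..<k}"
      using prod[OF \<open>n > 0\<close>] by (simp add: a_def b_def)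
    moreover have "0 < a i" for i using \<open>n > 0\<close> by (simp add: a_def)
    then have "prod a {..<j} \<noteq> 0" by simp
    ultimately have "prod a {j..<k} = prod b {j..<k}"
      unfolding split by (auto simp: prod.union_disjoint ivl_disj_int simp del: prod_zero_iff)
    moreover have "a i = n" if "i \<in> {j..<k}" for i
      using that chain[of j i] \<open>int n dvd d j\<close> by (auto simp: a_def intro: dvd_trans gcd_proj2_if_dvd)
    then have "prod a {j..<k} = n ^ card {j..<k}" by simp
    ultimately have prod_b: "prod b {j..<k} = n ^ card {j..<k}" by simp
    \<comment> \<open>Each factor is at most \<open>n\<close>, so a product equal to
      \<open>n ^ (k - j)\<close> leaves no room for \<open>b j < n\<close>.\<close>
    have le: "b i \<le> n" for i
      using \<open>n > 0\<close> by (simp add: b_def nat_le_iff gcd_le2_int)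
    have "b j \<noteq> n" using not_dvd \<open>n > 0\<close> unfolding b_def
      by (metis gcd_dvd1 gcd_ge_0_int int_nat_eq)
    then have "b j < n" using le[of j] by simp
    have "prod b {j..<k} = b j * prod b {Suc j..<k}"
      using \<open>j < k\<close> by (simp add: prod.atLeast_Suc_lessThan)
    also have "\<dots> \<le> b j * n ^ card {Suc j..<k}"
      using prod_mono[of "{Suc j..<k}" b "\<lambda>_. n"] le by simp
    also have "\<dots> < n * n ^ card {Suc j..<k}"
      using \<open>b j < n\<close> \<open>n > 0\<close> by simp
    also have "\<dots> = n ^ card {j..<k}"
      using \<open>j < k\<close> by (simp add: Suc_diff_Suc flip: power_Suc)
    finally show False using prod_b by simp
  qed
  show "d j dvd e j"
  proof (cases "d j = 0")
    case True
    \<comment> \<open>Every positive \<open>n\<close> divides 0; the choice of one larger than the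
      absolute value of \<open>e j\<close> forces \<open>e j = 0\<close>.\<close>
    have "\<bar>e j\<bar> + 1 dvd e j" using *[of "nat (\<bar>e j\<bar> + 1)"] True by simp
    then have "e j = 0" using zdvd_imp_le[of "\<bar>e j\<bar> + 1" "\<bar>e j\<bar>"] by fastforce
    then show ?thesis by simp
  next
    case False
    then show ?thesis using *[of "nat \<bar>d j\<bar>"] by simp
  qed
qed

section \<open>Abelianizations\<close>

definition abelianization :: "('a, 'b) monoid_scheme \<Rightarrow> 'a set monoid" where
  "abelianization G = G Mod derived G (carrier G)"

definition abelianization_map :: "('a, 'b) monoid_scheme \<Rightarrow> 'a \<Rightarrow> 'a set" where
  "abelianization_map G x = derived G (carrier G) #>\<^bsub>G\<^esub> x"

lemma comm_group_abelianization: "group G \<Longrightarrow> comm_group (abelianization G)"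
  by (simp add: abelianization_def group.derived_quot_is_comm_group)

lemma group_abelianization: "group G \<Longrightarrow> group (abelianization G)"
  using comm_group_abelianization[of G] by (simp add: comm_group_def)

lemma abelianization_map_epi:
  assumes "group G"
  shows "abelianization_map G \<in> epi G (abelianization G)"
proof -
  interpret normal "derived G (carrier G)" G
    using assms by (rule group.derived_self_is_normal)
  show ?thesis
    using r_coset_hom_Mod
    by (simp add: epi_def abelianization_def abelianization_map_def[abs_def] carrier_FactGroup)
qed

text \<open>\<open>\<chi>\<close> maps the derived subgroup of \<open>G\<close> onto that of
  \<open>Q\<close>, which is trivial since \<open>Q\<close> is abelian, so \<open>\<chi>\<close>
  factors through the quotient; surjectivity is inherited from the composite.\<close>

lemma abelianization_universal:
  assumes "group G" "comm_group Q" and \<chi>: "\<chi> \<in> epi G Q"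
  obtains \<chi>' where "\<chi>' \<in> epi (abelianization G) Q"
proof -
  interpret G: group G by fact
  interpret Q: comm_group Q by fact
  interpret \<chi>: group_hom G Q \<chi>
    using \<chi> by unfold_locales (auto simp: epi_def)
  have "\<chi> ` derived G (carrier G) = derived Q (carrier Q)"
    using \<chi>.derived_img[of "carrier G"] \<chi> by (simp add: epi_def)
  also have "\<dots> = {\<one>\<^bsub>Q\<^esub>}"
    using Q.derived_eq_singleton by simp
  finally have "derived G (carrier G) \<subseteq> kernel G Q \<chi>"
    using G.derived_in_carrier[of "carrier G"] by (auto simp: kernel_def)
  then obtain \<chi>' where \<chi>': "\<chi>' \<in> hom (abelianization G) Q"
    "\<And>x. x \<in> carrier G \<Longrightarrow> \<chi>' (abelianization_map G x) = \<chi> x"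
    using \<chi>.FactGroup_universal_kernel[OF G.derived_self_is_normal]
    unfolding abelianization_def abelianization_map_def by blast
  have "\<chi>' \<circ> abelianization_map G \<in> epi G Q"
  proof -
    have "\<chi>' \<circ> abelianization_map G \<in> hom G Q"
      using \<chi>' abelianization_map_epi[OF assms(1)] hom_compose by (auto simp: epi_def)
    moreover have "(\<chi>' \<circ> abelianization_map G) ` carrier G = \<chi> ` carrier G"
      using \<chi>'(2) by (auto simp: image_iff)
    ultimately show ?thesis using \<chi> by (simp add: epi_def)
  qed
  then have "\<chi>' \<in> epi (abelianization G) Q"
    using abelianization_map_epi[OF assms(1)] \<chi>'
    by (intro epi_compose_rev[of "abelianization_map G" G]) (auto simp: epi_def)
  then show thesis by (rule that)
qed

text \<open>Products of powers are additive in the exponents because \<open>A\<close> is abelian,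
  and the range is a subgroup that contains the generators.\<close>

lemma comm_group_spans:
  assumes "comm_group A" "set xs \<subseteq> carrier A" "generate A (set xs) = carrier A"
  shows "spans (length xs) (\<lambda>v. finprod A (\<lambda>i. xs ! i [^]\<^bsub>A\<^esub> v i) {..<length xs}) A"
    (is "spans ?k ?\<phi> A")
proof -
  interpret comm_group A by fact
  have xs: "xs ! i \<in> carrier A" if "i < ?k" for i
    using that assms(2) by (auto simp: subset_iff)
  have hom: "?\<phi> \<in> hom int_seqs A"
  proof (rule homI)
    show "?\<phi> (v \<otimes>\<^bsub>int_seqs\<^esub> w) = ?\<phi> v \<otimes>\<^bsub>A\<^esub> ?\<phi> w" for v w
    proof -
      have "?\<phi> (v \<otimes>\<^bsub>int_seqs\<^esub> w) =
          finprod A (\<lambda>i. xs ! i [^]\<^bsub>A\<^esub> v i \<otimes>\<^bsub>A\<^esub> xs ! i [^]\<^bsub>A\<^esub> w i) {..<?k}"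
        using xs by (intro finprod_cong') (auto simp: int_pow_mult)
      also have "\<dots> = ?\<phi> v \<otimes>\<^bsub>A\<^esub> ?\<phi> w"
        using xs by (intro finprod_multf) auto
      finally show ?thesis .
    qed
  qed (use xs in \<open>auto intro!: finprod_closed\<close>)
  interpret \<phi>: group_hom int_seqs A ?\<phi>
    using hom by (simp add: group_hom_def group_hom_axioms_def is_group)
  have "set xs \<subseteq> range ?\<phi>"
  proof
    fix x assume "x \<in> set xs"
    then obtain i where i: "i < ?k" "x = xs ! i" by (auto simp: in_set_conv_nth)
    have "?\<phi> (unit_vec i) = finprod A (\<lambda>j. if i = j then xs ! j else \<one>\<^bsub>A\<^esub>) {..<?k}"
      using xs by (intro finprod_cong') (auto simp: unit_vec_def)
    also have "\<dots> = x"
      using xs i finprod_singleton[of i "{..<?k}" "\<lambda>j. xs ! j"] by auto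
    finally show "x \<in> range ?\<phi>" by (rule range_eqI[of x ?\<phi> "unit_vec i", OF sym])
  qed
  then have "carrier A \<subseteq> range ?\<phi>"
    using generate_subgroup_incl[of "set xs" "range ?\<phi>"] \<phi>.img_is_subgroup assms(3) by simp
  then have "?\<phi> \<in> epi int_seqs A"
    using \<phi>.homh by (simp add: epi_iff_subset)
  moreover have "?\<phi> v = \<one>\<^bsub>A\<^esub>" if "\<forall>i<?k. v i = 0" for v
    using that xs by (intro finprod_one_eqI) auto
  ultimately show ?thesis by (simp add: spans_def)
qed

lemma finitely_generated_group_spans:
  assumes "finitely_generated_group G"
  obtains k \<phi> where "spans k \<phi> (abelianization G)"
proof -
  obtain S where S: "finite S" "S \<subseteq> carrier G" "generate G S = carrier G" and "group G"
    using assms by (auto simp: finitely_generated_group_def)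
  obtain xs where xs: "set xs = abelianization_map G ` S"
    using finite_list[OF finite_imageI[OF S(1), of "abelianization_map G"]] by (elim exE)
  have epi: "abelianization_map G \<in> hom G (abelianization G)"
    "abelianization_map G ` carrier G = carrier (abelianization G)"
    using abelianization_map_epi[OF \<open>group G\<close>] unfolding epi_def by blast+
  have p: "group_hom G (abelianization G) (abelianization_map G)"
    using \<open>group G\<close> group_abelianization[OF \<open>group G\<close>] epi(1)
    by (simp add: group_hom_def group_hom_axioms_def)
  have "generate (abelianization G) (set xs) = carrier (abelianization G)"
    using group_hom.generate_img[OF p S(2)] unfolding xs S(3) epi(2) .
  moreover have "set xs \<subseteq> carrier (abelianization G)"
    using S(2) epi(2) unfolding xs by blast
  ultimately show thesis
    using comm_group_spans[OF comm_group_abelianization[OF \<open>group G\<close>]] that by blast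
qed

text \<open>The left side is the order of \<open>residue_product k d n\<close>, a finite abelian
  quotient of \<open>G\<close> of exponent dividing \<open>n\<close>. Configuration equivalence
  makes it a quotient of \<open>H\<close>, hence of the abelianization of \<open>H\<close>, where
  \<open>diagonal_epi_card_le\<close> bounds its order.\<close>

lemma prod_gcd_le:
  assumes "finitely_generated_group G" "finitely_generated_group H" "G \<approx>\<^sub>c H"
    and "diagonal k \<phi> d (abelianization G)" "diagonal k \<psi> e (abelianization H)" "n > 0"
  shows "(\<Prod>i<k. nat (gcd (d i) (int n))) \<le> (\<Prod>i<k. nat (gcd (e i) (int n)))"
proof -
  have "group G" "group H" using assms by (auto simp: finitely_generated_group_def)
  define Q where "Q = residue_product k d n"
  note Q = residue_product[OF \<open>n > 0\<close>, of k d, folded Q_def]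
  note A = comm_group_abelianization[OF \<open>group G\<close>]
  obtain \<chi> where \<chi>: "\<chi> \<in> epi (abelianization G) Q"
    and pow: "\<And>a. a \<in> carrier (abelianization G) \<Longrightarrow> \<chi> (a [^]\<^bsub>abelianization G\<^esub> int n) = \<one>\<^bsub>Q\<^esub>"
    using diagonal_epi_residue_product[OF A assms(4,6)] unfolding Q_def by blast
  interpret Q: comm_group Q
    unfolding Q_def residue_product_def
  proof (rule group.group_comm_groupI)
  qed (auto simp: carrier_integer_mod_group add.commute)
  have exponent: "q [^]\<^bsub>Q\<^esub> int n = \<one>\<^bsub>Q\<^esub>" if q: "q \<in> carrier Q" for q
  proof -
    obtain a where a: "a \<in> carrier (abelianization G)" "q = \<chi> a"
      using \<chi> q by (auto simp: epi_def)
    then show ?thesis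
      using pow[OF a(1)] hom_int_pow[of \<chi> "abelianization G" Q a "int n"] \<chi>
        group_abelianization[OF \<open>group G\<close>] Q.is_group by (simp add: epi_def)
  qed
  have "\<chi> \<circ> abelianization_map G \<in> epi G Q"
    using abelianization_map_epi[OF \<open>group G\<close>] \<chi> by (rule epi_compose)
  then obtain \<theta> where "\<theta> \<in> epi H Q"
    using Con_eq_imp_finite_quotient[OF \<open>group G\<close> \<open>group H\<close> assms(1,3) Q(1,3)] by blast
  then obtain \<theta>' where \<theta>': "\<theta>' \<in> epi (abelianization H) Q"
    using abelianization_universal[OF \<open>group H\<close> Q.comm_group_axioms] by blast
  show ?thesis
    using diagonal_epi_card_le[OF group_abelianization[OF \<open>group H\<close>] assms(5,6) Q(1) \<theta>' exponent]
    unfolding Q(4) .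
qed

text \<open>Equality of all gcd products makes the divisors agree up to sign, so every relation for
  \<open>\<psi>\<close> is one for \<open>\<phi>\<close>, and the identity on coordinates induces
  the epimorphism.\<close>

lemma abelianization_epi_of_Con_eq:
  assumes "finitely_generated_group G" "finitely_generated_group H" "G \<approx>\<^sub>c H"
  obtains h where "h \<in> epi (abelianization H) (abelianization G)"
proof -
  have "group G" "group H" using assms by (auto simp: finitely_generated_group_def)
  note A = group_abelianization[OF \<open>group G\<close>] and B = group_abelianization[OF \<open>group H\<close>]
  have sym: "H \<approx>\<^sub>c G" using assms(3) by (simp add: configuration_equivalent_def)
  obtain k\<^sub>1 \<phi>\<^sub>1 where 1: "spans k\<^sub>1 \<phi>\<^sub>1 (abelianization G)"
    using finitely_generated_group_spans[OF assms(1)] .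
  obtain k\<^sub>2 \<phi>\<^sub>2 where 2: "spans k\<^sub>2 \<phi>\<^sub>2 (abelianization H)"
    using finitely_generated_group_spans[OF assms(2)] .
  \<comment> \<open>The divisors are compared as lists of one length, so both coordinate maps are
    padded to the larger number of coordinates.\<close>
  define k where "k = max k\<^sub>1 k\<^sub>2"
  obtain \<phi> d where \<phi>: "diagonal k \<phi> d (abelianization G)"
    using ex_diagonal[OF A spans_mono[OF 1, of k]] by (auto simp: k_def)
  obtain \<psi> e where \<psi>: "diagonal k \<psi> e (abelianization H)"
    using ex_diagonal[OF B spans_mono[OF 2, of k]] by (auto simp: k_def)
  have eq: "(\<Prod>i<k. nat (gcd (d i) (int n))) = (\<Prod>i<k. nat (gcd (e i) (int n)))" if "n > 0" for n
    using prod_gcd_le[OF assms \<phi> \<psi> that] prod_gcd_le[OF assms(2,1) sym \<psi> \<phi> that] by simp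
  have chain: "d l dvd d i" "e l dvd e i" if "l \<le> i" "i < k" for l i
    using \<phi> \<psi> that by (simp_all add: diagonal_def)
  have dvd: "d j dvd e j \<and> e j dvd d j" if "j < k" for j
    using that
  proof (induction j rule: less_induct)
    case (less j)
    then have below: "d i dvd e i \<and> e i dvd d i" if "i < j" for i
      using that by simp
    show ?case
      using elementary_divisor_dvd[of k d e j] elementary_divisor_dvd[of k e d j] chain eq below less.prems
      by simp
  qed
  have ker: "\<phi> v = \<one>\<^bsub>abelianization G\<^esub>" if "\<psi> v = \<one>\<^bsub>abelianization H\<^esub>" for v
    using that \<phi> \<psi> dvd unfolding diagonal_def by (meson dvd_trans)
  have \<phi>_epi: "\<phi> \<in> epi int_seqs (abelianization G)" and \<psi>_epi: "\<psi> \<in> epi int_seqs (abelianization H)"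
    using \<phi> \<psi> by (simp_all add: diagonal_def)
  obtain h where h: "h \<in> hom (abelianization H) (abelianization G)" "\<And>v. h (\<psi> v) = \<phi> v"
    using epi_factor[OF group_int_seqs B A \<psi>_epi diagonal_hom[OF \<phi>]] ker by auto
  have "h \<circ> \<psi> = \<phi>" using h(2) by (simp add: fun_eq_iff)
  then have "h \<in> epi (abelianization H) (abelianization G)"
    using h(1) \<phi>_epi diagonal_hom[OF \<psi>] by (intro epi_compose_rev[of \<psi> int_seqs]) auto
  then show thesis by (rule that)
qed

text \<open>\<open>K\<close> is an image of the abelianization of \<open>G\<close>, hence of that of
  \<open>H\<close> and of \<open>H\<close> itself. The first isomorphism theorem replaces it by the
  quotient of \<open>H\<close> by a kernel, a member of \<open>abelian_quotients H\<close>.\<close>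

lemma abelian_quotients_of_Con_eq:
  assumes "finitely_generated_group G" "finitely_generated_group H" "G \<approx>\<^sub>c H"
    and "K \<in> abelian_quotients G"
  shows "\<exists>L\<in>abelian_quotients H. K \<cong> L"
proof -
  have "group G" "group H" using assms by (auto simp: finitely_generated_group_def)
  obtain N where N: "N \<lhd> G" "comm_group K" "K = G Mod N"
    using assms(4) by (auto simp: abelian_quotients_def)
  interpret K: comm_group K by fact
  have "(\<lambda>x. N #>\<^bsub>G\<^esub> x) \<in> epi G K"
    using normal.r_coset_hom_Mod[OF N(1)] by (simp add: epi_def N(3) carrier_FactGroup)
  then obtain \<pi> where \<pi>: "\<pi> \<in> epi (abelianization G) K"
    using abelianization_universal[OF \<open>group G\<close> N(2)] by blast
  obtain h where h: "h \<in> epi (abelianization H) (abelianization G)"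
    using abelianization_epi_of_Con_eq[OF assms(1-3)] .
  define \<theta> where "\<theta> = \<pi> \<circ> (h \<circ> abelianization_map H)"
  have "\<theta> \<in> epi H K"
    unfolding \<theta>_def by (intro epi_compose[OF epi_compose[OF abelianization_map_epi[OF \<open>group H\<close>] h] \<pi>])
  then interpret \<theta>: group_hom H K \<theta>
    using \<open>group H\<close> K.is_group by (simp add: group_hom_def group_hom_axioms_def epi_def)
  define L where "L = H Mod kernel H K \<theta>"
  have iso: "L \<cong> K"
    using \<theta>.FactGroup_iso \<open>\<theta> \<in> epi H K\<close> by (simp add: L_def epi_def)
  have "group L"
    unfolding L_def using \<theta>.normal_kernel by (rule normal.factorgroup_is_group)
  then have "K \<cong> L" using iso by (rule group.iso_sym)
  moreover have "comm_group L"
    using K.iso_imp_comm_group[of L] \<open>K \<cong> L\<close> \<open>group L\<close> by (simp add: group.is_monoid)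
  then have "L \<in> abelian_quotients H"
    using \<theta>.normal_kernel unfolding abelian_quotients_def L_def by blast
  ultimately show ?thesis by blast
qed

theorem proposition2p3:
  fixes G :: "('a, 'c) monoid_scheme" and H :: "('b, 'd) monoid_scheme"
  assumes "finitely_generated_group G"
    and "finitely_generated_group H"
    and "G \<approx>\<^sub>c H"
  shows "same_isomorphism_types (abelian_quotients G) (abelian_quotients H)"
proof -
  have "H \<approx>\<^sub>c G" using assms(3) by (simp add: configuration_equivalent_def)
  then show ?thesis
    using abelian_quotients_of_Con_eq[OF assms] abelian_quotients_of_Con_eq[OF assms(2,1)]
    by (simp add: same_isomorphism_types_def)
qed

end
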